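(* For all $n\in\mathbb{N}$ with $n\ge1$ and all $X\in\mathrm{IS}$: if $X$ computes $\mathrm{tstnz}_n$, then $\mathrm{len}(X)\ge L(n)$, where $L(n)=3n/2+1$ if $n$ is even and $L(n)=3(n+1)/2$ if $n$ is odd.
   Context: Basic instructions: $\mathtt{in}{:}i.\mathtt{get}$ ($i\ge1$), $\mathtt{out}.\mathtt{set}{:}b$ ($b\in\{0,1\}$), $\mathtt{aux}{:}i.\mathtt{get}$ ($i\ge1$), $\mathtt{aux}{:}i.\mathtt{set}{:}b$ ($i\ge1$, $b\in\{0,1\}$). The part before the dot names a Boolean register ($\mathtt{in}{:}i$ input, $\mathtt{out}$ output, $\mathtt{aux}{:}i$ auxiliary); $\mathtt{get}$ changes nothing and replies the content, $\mathtt{set}{:}b$ makes the content $b$ and replies $b$. Primitive instructions: for each basic instruction $a$, plain $a$, positive test $+a$, negative test $-a$; forward jumps $\#l$ ($l\in\mathbb{N}$); termination $!$. $\mathrm{IS}$ is the set of finite sequences $X=u_1;\dots;u_k$ of primitive instructions, $\mathrm{len}(X)=k$. Execution starts at $u_1$: plain $a$ executes $a$ and proceeds with the next instruction; $+a$ executes $a$ and proceeds with the next instruction if the reply is $1$, otherwise skips the next one and proceeds with the one after it; $-a$ likewise with replies reversed; $\#l$ proceeds with the $l$-th next instruction; $!$ terminates. If $l=0$ or there is no instruction to proceed with, execution never terminates. For $f:\{0,1\}^n\to\{0,1\}$, $X$ computes $f$ if there is $k$ such that for all $b_1,\dots,b_n$, executing $X$ with $\mathtt{in}{:}i$ initially $b_i$,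 $\mathtt{out}$ and $\mathtt{aux}{:}1,\dots,\mathtt{aux}{:}k$ initially $0$ (other registers arbitrary) terminates with final content of $\mathtt{out}$ equal to $f(b_1,\dots,b_n)$. $\mathrm{tstnz}_n:\{0,1\}^n\to\{0,1\}$: $\mathrm{tstnz}_n(b_1,\dots,b_n)=1$ iff some $b_i=1$. *)

theory Defs
  imports Main
begin

text \<open>Boolean contents and replies 1 and 0 are rendered as \<^term>\<open>True\<close> and \<^term>\<open>False\<close>.\<close>

datatype register = In nat | Out | Aux nat

datatype basic = InGet nat | OutSet bool | AuxGet nat | AuxSet nat bool

datatype instr = Plain basic | PosTest basic | NegTest basic | Jump nat | Halt

type_synonym state = "register \<Rightarrow> bool"

fun basic_ok :: "basic \<Rightarrow> bool" where
  "basic_ok (InGet i) \<longleftrightarrow> i \<ge> 1"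
| "basic_ok (OutSet b) \<longleftrightarrow> True"
| "basic_ok (AuxGet i) \<longleftrightarrow> i \<ge> 1"
| "basic_ok (AuxSet i b) \<longleftrightarrow> i \<ge> 1"

fun instr_ok :: "instr \<Rightarrow> bool" where
  "instr_ok (Plain a) \<longleftrightarrow> basic_ok a"
| "instr_ok (PosTest a) \<longleftrightarrow> basic_ok a"
| "instr_ok (NegTest a) \<longleftrightarrow> basic_ok a"
| "instr_ok (Jump l) \<longleftrightarrow> True"
| "instr_ok Halt \<longleftrightarrow> True"

definition IS :: "instr list set" where
  "IS = {X. \<forall>u \<in> set X. instr_ok u}"

fun effect :: "basic \<Rightarrow> state \<Rightarrow> state" where
  "effect (InGet i) s = s"
| "effect (OutSet b) s = s(Out := b)"
| "effect (AuxGet i) s = s"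
| "effect (AuxSet i b) s = s(Aux i := b)"

fun reply :: "basic \<Rightarrow> state \<Rightarrow> bool" where
  "reply (InGet i) s = s (In i)"
| "reply (OutSet b) s = b"
| "reply (AuxGet i) s = s (Aux i)"
| "reply (AuxSet i b) s = b"

text \<open>
  Control only moves forward, so the position of execution is represented by the
  remaining suffix of the instruction sequence. The result is the final state, or
  \<^const>\<open>None\<close> if execution never terminates: the suffix is exhausted, or \<^term>\<open>Jump 0\<close>
  is reached. After the head has been removed, the l-th next instruction is the head of
  \<^term>\<open>drop (l - 1) us\<close>.
\<close>

fun exec :: "instr list \<Rightarrow> state \<Rightarrow> state option" where
  "exec [] s = None"
| "exec (Plain a # us) s = exec us (effect a s)"
| "exec (PosTest a # us) s = exec (if reply a s then us else drop 1 us) (effect a s)"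
| "exec (NegTest a # us) s = exec (if reply a s then drop 1 us else us) (effect a s)"
| "exec (Jump l # us) s = (if l = 0 then None else exec (drop (l - 1) us) s)"
| "exec (Halt # us) s = Some s"

text \<open>
  A function from n-tuples of Booleans is given by its values on lists of length n; the
  component with number i (counted from 1) is \<^term>\<open>bs ! (i - 1)\<close>.
\<close>

definition computes :: "nat \<Rightarrow> instr list \<Rightarrow> (bool list \<Rightarrow> bool) \<Rightarrow> bool" where
  "computes n X f \<longleftrightarrow>
     (\<exists>k::nat. \<forall>bs. length bs = n \<longrightarrow>
        (\<forall>s. (\<forall>i\<in>{1..n}. s (In i) = bs ! (i - 1)) \<and> s Out = False \<and> (\<forall>i\<in>{1..k}. s (Aux i) = False) \<longrightarrow>
           (\<exists>s'. exec X s = Some s' \<and> s' Out = f bs)))"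

definition tstnz :: "nat \<Rightarrow> bool list \<Rightarrow> bool" where
  "tstnz n bs \<longleftrightarrow> (\<exists>i\<in>{1..n}. bs ! (i - 1) = True)"

end

theory Submission
  imports Defs
begin

text \<open>
  Induct on the length of the instruction sequence, for the more general claim that a sequence
  testing a set of \<open>n\<close> inputs from an arbitrary fixed state has length at least
  \<open>n + 1 + \<lceil>n / 2\<rceil>\<close>. An instruction that does not test one of these inputs can be dropped.
  If the first instruction tests input \<open>i\<close>, follow the branch \<open>i = 0\<close>, which tests the
  remaining inputs. This suffices if that branch skips an instruction or \<open>n\<close> is even. Otherwise
  look at the second instruction; the only critical case is that both are negative tests, of
  inputs \<open>i\<close> and \<open>j\<close>. There, if \<open>j = 0\<close>, the third instruction is reached whatever \<open>i\<close> is, so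
  the sequence starting at it still has to test all inputs except \<open>j\<close>.
\<close>

text \<open>
  Registers other than the inputs in \<open>S\<close> have their contents in \<open>s\<close>; the contents of \<open>s\<close> at the
  inputs in \<open>S\<close> are irrelevant.
\<close>

definition tests_nonzero :: "nat set \<Rightarrow> instr list \<Rightarrow> state \<Rightarrow> bool" where
  "tests_nonzero S Y s \<longleftrightarrow>
     (\<forall>t. (\<forall>r. r \<notin> In ` S \<longrightarrow> t r = s r) \<longrightarrow>
        (\<exists>t'. exec Y t = Some t' \<and> (t' Out \<longleftrightarrow> (\<exists>i\<in>S. t (In i)))))"

lemma tests_nonzeroI:
  assumes "\<And>t. (\<And>r. r \<notin> In ` S \<Longrightarrow> t r = s r) \<Longrightarrow>
    \<exists>t'. exec Y t = Some t' \<and> (t' Out \<longleftrightarrow> (\<exists>i\<in>S. t (In i)))"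
  shows "tests_nonzero S Y s"
  using assms unfolding tests_nonzero_def by blast

lemma tests_nonzeroD:
  assumes "tests_nonzero S Y s" and "\<And>r. r \<notin> In ` S \<Longrightarrow> t r = s r"
  shows "\<exists>t'. exec Y t = Some t' \<and> (t' Out \<longleftrightarrow> (\<exists>i\<in>S. t (In i)))"
  using assms unfolding tests_nonzero_def by blast

lemma tests_nonzero_not_Nil: "\<not> tests_nonzero S [] s"
  using tests_nonzeroD[of S "[]" s s] by auto

text \<open>Halting at once leaves \<open>Out\<close> as in \<open>s\<close>, whereas for nonempty
  \<open>S\<close> the all-zero and all-one inputs on \<open>S\<close> call for different
  outputs.\<close>

lemma tests_nonzero_Halt:
  assumes "tests_nonzero S (Halt # us) s"
  shows "S = {}"
proof (rule ccontr)
  assume "S \<noteq> {}"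
  then obtain i where i: "i \<in> S" by blast
  define t where "t b r = (if r \<in> In ` S then b else s r)" for b :: bool and r
  have "t b Out \<longleftrightarrow> b" for b
    using tests_nonzeroD[OF assms, of "t b"] i by (auto simp: t_def)
  moreover have "t True Out = t False Out"
    by (auto simp: t_def)
  ultimately show False by blast
qed

text \<open>No basic instruction alters an input, so every state agreeing with
  \<open>effect a s\<close> outside \<open>S\<close> arises by \<open>effect a\<close> from one
  agreeing with \<open>s\<close> there.\<close>

lemma tests_nonzero_after_effect:
  assumes Y: "tests_nonzero S Y s"
    and Z: "\<And>t. (\<And>r. r \<notin> In ` S \<Longrightarrow> t r = s r) \<Longrightarrow> exec Y t = exec Z (effect a t)"
  shows "tests_nonzero S Z (effect a s)"
proof (rule tests_nonzeroI)
  fix t assume t: "\<And>r. r \<notin> In ` S \<Longrightarrow> t r = effect a s r"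
  define t0 where "t0 r = (if r \<in> In ` S then t r else s r)" for r
  have "effect a t0 = t"
    using t by (cases a) (force simp: t0_def fun_eq_iff)+
  moreover have "t0 (In i) = t (In i)" if "i \<in> S" for i
    using that by (simp add: t0_def)
  ultimately show "\<exists>t'. exec Z t = Some t' \<and> (t' Out \<longleftrightarrow> (\<exists>i\<in>S. t (In i)))"
    using tests_nonzeroD[OF Y, of t0] Z[of t0] by (auto simp: t0_def)
qed

text \<open>The reply, if any, is the same in all states considered, so control always proceeds to
  the same suffix.\<close>

lemma tests_nonzero_skip:
  assumes Y: "tests_nonzero S (u # us) s"
    and "u \<noteq> Halt"
    and "\<And>i. i \<in> S \<Longrightarrow> u \<noteq> PosTest (InGet i) \<and> u \<noteq> NegTest (InGet i)"
  shows "\<exists>k s'. tests_nonzero S (drop k us) s'"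
proof -
  have reply: "reply a t = reply a s"
    if "\<And>r. r \<notin> In ` S \<Longrightarrow> t r = s r" and "\<And>i. i \<in> S \<Longrightarrow> a \<noteq> InGet i" for a t
    using that by (cases a) auto
  show ?thesis
  proof (cases u)
    case (Plain a)
    have "tests_nonzero S (drop 0 us) (effect a s)"
      by (rule tests_nonzero_after_effect[OF Y]) (simp add: Plain)
    then show ?thesis by blast
  next
    case (PosTest a)
    have "tests_nonzero S (drop (if reply a s then 0 else 1) us) (effect a s)"
    proof (rule tests_nonzero_after_effect[OF Y])
      fix t assume "\<And>r. r \<notin> In ` S \<Longrightarrow> t r = s r"
      then have "reply a t = reply a s"
        using assms(3) PosTest by (intro reply) auto
      then show "exec (u # us) t = exec (drop (if reply a s then 0 else 1) us) (effect a t)"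
        by (simp add: PosTest)
    qed
    then show ?thesis by blast
  next
    case (NegTest a)
    have "tests_nonzero S (drop (if reply a s then 1 else 0) us) (effect a s)"
    proof (rule tests_nonzero_after_effect[OF Y])
      fix t assume "\<And>r. r \<notin> In ` S \<Longrightarrow> t r = s r"
      then have "reply a t = reply a s"
        using assms(3) NegTest by (intro reply) auto
      then show "exec (u # us) t = exec (drop (if reply a s then 1 else 0) us) (effect a t)"
        by (simp add: NegTest)
    qed
    then show ?thesis by blast
  next
    case (Jump l)
    have "l \<noteq> 0"
      using tests_nonzeroD[OF Y, of s] by (auto simp: Jump split: if_splits)
    then have "tests_nonzero S (drop (l - 1) us) s"
      using Y by (simp add: Jump tests_nonzero_def)
    then show ?thesis by blast
  next
    case Halt
    with assms(2) show ?thesis by blast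
  qed
qed

text \<open>An input held at 0 contributes nothing to the disjunction, so it can join the fixed
  registers.\<close>

lemma tests_nonzero_zero_input:
  assumes Y: "tests_nonzero S Y s" and "j \<in> S"
    and Z: "\<And>t. \<not> t (In j) \<Longrightarrow> exec Y t = exec Z t"
  shows "tests_nonzero (S - {j}) Z (s(In j := False))"
proof (rule tests_nonzeroI)
  fix t assume t: "\<And>r. r \<notin> In ` (S - {j}) \<Longrightarrow> t r = (s(In j := False)) r"
  have j: "\<not> t (In j)" using t[of "In j"] by auto
  have "t r = s r" if "r \<notin> In ` S" for r
  proof -
    have "r \<notin> In ` (S - {j})" "r \<noteq> In j" using that \<open>j \<in> S\<close> by auto
    then show ?thesis using t[of r] by simp
  qed
  then have "\<exists>t'. exec Z t = Some t' \<and> (t' Out \<longleftrightarrow> (\<exists>i\<in>S. t (In i)))"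
    using tests_nonzeroD[OF Y, of t] Z[of t, OF j] by simp
  moreover have "(\<exists>i\<in>S. t (In i)) \<longleftrightarrow> (\<exists>i\<in>S - {j}. t (In i))"
    using j by auto
  ultimately show "\<exists>t'. exec Z t = Some t' \<and> (t' Out \<longleftrightarrow> (\<exists>i\<in>S - {j}. t (In i)))"
    by simp
qed

lemma first_instruction_cases:
  assumes "tests_nonzero S Y s"
  obtains (Halt) us where "Y = Halt # us" "S = {}"
  | (Skip) u us k s' where "Y = u # us" "tests_nonzero S (drop k us) s'"
  | (Pos) i us s' where "Y = PosTest (InGet i) # us" "i \<in> S" "tests_nonzero (S - {i}) (drop 1 us) s'"
  | (Neg) i us s' where "Y = NegTest (InGet i) # us" "i \<in> S" "tests_nonzero (S - {i}) us s'"
proof -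
  from assms obtain u us where Y: "Y = u # us"
    using tests_nonzero_not_Nil by (cases Y) auto
  note tests = assms[unfolded Y]
  consider "u = Halt" | i where "i \<in> S" "u = PosTest (InGet i)"
    | i where "i \<in> S" "u = NegTest (InGet i)"
    | "u \<noteq> Halt" "\<And>i. i \<in> S \<Longrightarrow> u \<noteq> PosTest (InGet i) \<and> u \<noteq> NegTest (InGet i)"
    by blast
  then show thesis
  proof cases
    case 1
    then show thesis using Halt Y tests_nonzero_Halt tests by blast
  next
    case (2 i)
    then have "tests_nonzero (S - {i}) (drop 1 us) (s(In i := False))"
      by (intro tests_nonzero_zero_input[OF tests]) auto
    then show thesis using Pos 2 Y by blast
  next
    case (3 i)
    then have "tests_nonzero (S - {i}) us (s(In i := False))"
      by (intro tests_nonzero_zero_input[OF tests]) auto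
    then show thesis using Neg 3 Y by blast
  next
    case 4
    then show thesis using Skip Y tests_nonzero_skip[OF tests] by blast
  qed
qed

lemma tests_nonzero_length:
  assumes "finite S" and "tests_nonzero S Y s"
  shows "card S + 1 + (card S + 1) div 2 \<le> length Y"
  using assms
proof (induction Y arbitrary: S s rule: length_induct)
  case (1 Y)
  have IH: "card T + 1 + (card T + 1) div 2 \<le> length Z"
    if "tests_nonzero T Z t" "length Z < length Y" "T \<subseteq> S" for T Z t
    using 1 that finite_subset by blast
  note card_remove = card_Suc_Diff1[OF \<open>finite S\<close>]
  from \<open>tests_nonzero S Y s\<close> show ?case
  proof (cases rule: first_instruction_cases)
    case (Halt us)
    then show ?thesis by simp
  next
    case (Skip u us k s')
    then show ?thesis using IH[OF Skip(2)] by force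
  next
    case (Pos i us s')
    \<comment> \<open>Since \<open>us\<close> is nonempty, \<open>drop 1\<close> removes an
      instruction: two are spent on one input.\<close>
    have "us \<noteq> []" using Pos(3) tests_nonzero_not_Nil by auto
    then show ?thesis using IH[OF Pos(3)] Pos(1) card_remove[OF Pos(2)] by (cases us) auto
  next
    case (Neg i us s')
    note n = card_remove[OF Neg(2)]
    have len: "card (S - {i}) + 1 + (card (S - {i}) + 1) div 2 \<le> length us"
      using IH[OF Neg(3)] Neg(1) by auto
    show ?thesis
    proof (cases "even (card S)")
      case True
      \<comment> \<open>Removing one input from an even number leaves
        \<open>(card S + 1) div 2\<close> unchanged, so one instruction suffices.\<close>
      then show ?thesis using len n Neg(1) by (auto elim!: evenE)
    next
      case odd: False
      from Neg(3) show ?thesis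
      proof (cases rule: first_instruction_cases)
        case (Halt vs)
        \<comment> \<open>With input \<open>i\<close> equal to 1 the \<open>Halt\<close> is skipped,
          so a third instruction must follow.\<close>
        have "(s(In i := True)) r = s r" if "r \<notin> In ` S" for r
          using that Neg(2) by auto
        from tests_nonzeroD[OF \<open>tests_nonzero S Y s\<close>, OF this] have "vs \<noteq> []"
          using Neg(1) Halt(1) by auto
        moreover have "card S = 1" using n Halt(2) by (metis One_nat_def card.empty)
        ultimately show ?thesis using Halt(1) Neg(1) by (cases vs) auto
      next
        case (Skip v vs k t)
        \<comment> \<open>Two instructions are spent on one input.\<close>
        have "card (S - {i}) + 1 + (card (S - {i}) + 1) div 2 \<le> length (drop k vs)"
          using IH[OF Skip(2)] Skip(1) Neg(1) by auto
        then show ?thesis using n Skip(1) Neg(1) by auto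
      next
        case (Pos j vs t)
        \<comment> \<open>Three instructions, the last one skipped, are spent on two inputs, which
          is the exact rate of the bound.\<close>
        have "vs \<noteq> []" using Pos(3) tests_nonzero_not_Nil by auto
        moreover have "Suc (card (S - {i} - {j})) = card (S - {i})"
          using Pos(2) \<open>finite S\<close> by (intro card_Suc_Diff1) auto
        moreover have "S - {i} - {j} \<subseteq> S" by blast
        moreover obtain m where "card S = 2 * m + 1" using odd by (elim oddE)
        ultimately show ?thesis
          using IH[OF Pos(3)] n Pos(1) Neg(1) by (cases vs) auto
      next
        case Neg': (Neg j vs t)
        have j: "j \<in> S" using Neg' by simp
        \<comment> \<open>If \<open>i\<close> is 1 the second test is skipped; if \<open>i\<close>
          is 0 it is executed and, as \<open>j\<close> is 0, skips nothing. Two instructions thus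
          cost only the input \<open>j\<close>.\<close>
        have "tests_nonzero (S - {j}) vs (s(In j := False))"
          by (rule tests_nonzero_zero_input[OF \<open>tests_nonzero S Y s\<close> j])
            (simp add: Neg(1) Neg'(1))
        from IH[OF this] show ?thesis
          using card_remove[OF j] Neg(1) Neg'(1) by auto
      qed
    qed
  qed
qed

lemma computes_tstnz_tests_nonzero:
  assumes "computes n X (tstnz n)"
  shows "tests_nonzero {1..n} X (\<lambda>_. False)"
proof (rule tests_nonzeroI)
  fix t :: state
  assume t: "\<And>r. r \<notin> In ` {1..n} \<Longrightarrow> t r = False"
  define bs where "bs = map (\<lambda>i. t (In (Suc i))) [0..<n]"
  have bs: "bs ! (i - 1) = t (In i)" if "i \<in> {1..n}" for i
    using that by (auto simp: bs_def)
  have length: "length bs = n" by (simp add: bs_def)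
  from assms obtain k where
    k: "\<forall>bs. length bs = n \<longrightarrow>
        (\<forall>s. (\<forall>i\<in>{1..n}. s (In i) = bs ! (i - 1)) \<and> s Out = False \<and> (\<forall>i\<in>{1..k}. s (Aux i) = False) \<longrightarrow>
           (\<exists>s'. exec X s = Some s' \<and> s' Out = tstnz n bs))"
    unfolding computes_def by (rule exE)
  \<comment> \<open>All auxiliary registers are 0, so \<open>t\<close> is a valid initial state
    whatever \<open>k\<close> is.\<close>
  have "t Out = False" "t (Aux i) = False" for i
    by (rule t; blast)+
  then have "\<exists>t'. exec X t = Some t' \<and> t' Out = tstnz n bs"
    by (intro k[rule_format, OF length] conjI ballI) (simp_all only: bs)
  then obtain t' where "exec X t = Some t'" "t' Out = tstnz n bs"
    by blast
  moreover have "tstnz n bs \<longleftrightarrow> (\<exists>i\<in>{1..n}. t (In i))"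
    using bs by (auto simp: tstnz_def)
  ultimately show "\<exists>t'. exec X t = Some t' \<and> (t' Out \<longleftrightarrow> (\<exists>i\<in>{1..n}. t (In i)))"
    by simp
qed

theorem theorem1:
  fixes n :: nat and X :: "instr list"
  assumes "n \<ge> 1"
    and "X \<in> IS"
    and "computes n X (tstnz n)"
  shows "length X \<ge> (if even n then (3 * n) div 2 + 1 else (3 * (n + 1)) div 2)"
proof -
  have "n + 1 + (n + 1) div 2 \<le> length X"
    using tests_nonzero_length[OF _ computes_tstnz_tests_nonzero[OF assms(3)]] by simp
  then show ?thesis by (auto elim!: evenE oddE)
qed

end
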